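(* Let $H=(\mathrm{Loc},X,\mathrm{Edg}_c,\mathrm{Edg}_u,\mathrm{Flow},\mathrm{Inv},\mathrm{Init})$ be a well-formed Linear Hybrid Automaton. For every strategy $\sigma$ and every initial state $s\in\mathrm{InitS}$, there exists a run that starts from $s$ and is consistent with $\sigma$.
   Context: A convex polyhedron in $\mathbb{R}^n$ is a finite intersection of strict or non-strict affine half-spaces; a polyhedron is a finite union of convex polyhedra. $X=\{x_1,\dots,x_n\}$, $\mathrm{Val}(X)\cong\mathbb{R}^n$ the valuations, $X'$ primed copies. An activity is a differentiable $f:\mathbb{R}_{\ge0}\to\mathrm{Val}(X)$. An LHA $H$ has a finite set $\mathrm{Loc}$ of locations; finite sets $\mathrm{Edg}_c$ (controllable) and $\mathrm{Edg}_u$ (uncontrollable) of transitions $(l,\mu,l')$, $\mu$ a polyhedron over $X\cup X'$; for each $l$ a convex polyhedron $\mathrm{Flow}(l)$ of allowed derivatives and polyhedra $\mathrm{Init}(l)\subseteq\mathrm{Inv}(l)\subseteq\mathrm{Val}(X)$. States $S=\mathrm{Loc}\times\mathrm{Val}(X)$; $\mathrm{InvS}=\bigcup_l\{l\}\times\mathrm{Inv}(l)$, $\mathrm{InitS}=\bigcup_l\{l\}\times\mathrm{Init}(l)$; for $s=\langle l,v\rangle$, $\mathrm{loc}(s)=l$, $\mathrm{val}(s)=v$. $f$ is admissible from $s=\langle l,v\rangle$ ($f\in\mathrm{Adm}(s)$) if $f(0)=v$ and $\dot f(\delta)\in\mathrm{Flow}(l)$ for all $\delta\ge0$. $\mathrm{span}(f,l)=\{\delta\ge0\mid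 \forall 0\le\delta'\le\delta: \langle l,f(\delta')\rangle\in\mathrm{InvS}\}$; $\infty\in\mathrm{span}(f,l)$ if it contains all nonnegative reals. Discrete step $s\xrightarrow{e}s'$: $s,s'\in\mathrm{InvS}$, $e=(\mathrm{loc}(s),\mu,\mathrm{loc}(s'))$, $(\mathrm{val}(s),\mathrm{val}(s')[X'/X])\in\mu$. Timed step $s\xrightarrow{\delta,f}s'$: $s\in\mathrm{InvS}$, $f\in\mathrm{Adm}(s)$, $\delta\in\mathrm{span}(f,\mathrm{loc}(s))$ (zero allowed), $s'=\langle\mathrm{loc}(s),f(\delta)\rangle$; $s\xrightarrow{\infty,f}$ allowed iff $\infty\in\mathrm{span}(f,\mathrm{loc}(s))$. A run is a sequence $s_0\xrightarrow{\delta_0,f_0}s_0'\xrightarrow{e_0}s_1\xrightarrow{\delta_1,f_1}s_1'\xrightarrow{e_1}\cdots$ of alternating timed and discrete steps, either infinite or ending with $s_n\xrightarrow{\infty,f_n}$. A run is non-Zeno if for every $\delta\ge0$ some $i$ has $\sum_{j\le i}\delta_j>\delta$. $H$ is well-formed if all runs are non-Zeno and, for every $s\in\mathrm{InvS}$ such that every $f\in\mathrm{Adm}(s)$ eventually leaves the invariant, there exist $f\in\mathrm{Adm}(s)$, $\delta\in\mathrm{span}(f,\mathrm{loc}(s))$ and $e\in\mathrm{Edg}_u$ with $\langle\mathrm{loc}(s),f(\delta)\rangle\in\mathrm{InvS}$ and $\langle\mathrm{loc}(s),f(\delta)\rangle\xrightarrow{e}s''$ for some $s''$. A strategy is $\sigma:S\to2^{\mathrm{Edg}_c\cup\{\bot\}}\setminus\{\emptyset\}$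 ($\bot$ the null action) such that: if $e\in\sigma(s)\cap\mathrm{Edg}_c$ then $s\xrightarrow{e}s'$ for some $s'$; if $\bot\in\sigma(s)$ then for every $f\in\mathrm{Adm}(s)$ there exists $\delta>0$ with, for all $0<\delta'<\delta$, $\delta'\notin\mathrm{span}(f,\mathrm{loc}(s))$ or $\bot\in\sigma(\langle\mathrm{loc}(s),f(\delta')\rangle)$. A run is consistent with $\sigma$ if for each index $i$ below its length, $\bot\in\sigma(\langle\mathrm{loc}(s_i),f_i(\delta)\rangle)$ for all $0\le\delta<\delta_i$, and $e_i\in\sigma(s_i')$ whenever $e_i\in\mathrm{Edg}_c$.
   Formalization: The sets of controllable and uncontrollable transitions are assumed disjoint; if a transition may be in both, the claim fails (a single transition in both sets, an invariant that must be left, and the strategy that always allows only the null action). *)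

theory Defs
  imports "HOL-Analysis.Analysis" "HOL-Library.Extended_Nat" "HOL-Library.Extended_Real"
begin

(* The library constant polyhedron covers only closed convex polyhedra; here the half-spaces
   may be open or closed, and finite unions are allowed. *)

definition affine_halfspace :: "'a::real_inner set \<Rightarrow> bool" where
  "affine_halfspace A \<longleftrightarrow>
     (\<exists>a b. a \<noteq> 0 \<and> (A = {x. a \<bullet> x \<le> b} \<or> A = {x. a \<bullet> x < b}))"

definition convex_polyhedral :: "'a::real_inner set \<Rightarrow> bool" where
  "convex_polyhedral P \<longleftrightarrow> (\<exists>\<H>. finite \<H> \<and> (\<forall>A\<in>\<H>. affine_halfspace A) \<and> P = \<Inter>\<H>)"

definition polyhedral :: "'a::real_inner set \<Rightarrow> bool" where
  "polyhedral P \<longleftrightarrow> (\<exists>\<C>. finite \<C> \<and> (\<forall>C\<in>\<C>. convex_polyhedral C) \<and> P = \<Union>\<C>)"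

(* The finite type 'x plays the role of the set X of variables. A valuation of the variables
   together with their primed copies is a pair (v, v') of valuations, v' giving the values of
   the primed variables. *)

type_synonym 'x val = "(real, 'x) vec"
type_synonym ('l, 'x) state = "'l \<times> 'x val"
type_synonym ('l, 'x) edge = "'l \<times> ('x val \<times> 'x val) set \<times> 'l"

record ('l, 'x) automaton =
  Loc :: "'l set"
  Edgc :: "('l, 'x) edge set"
  Edgu :: "('l, 'x) edge set"
  Flow :: "'l \<Rightarrow> 'x val set"
  Inv :: "'l \<Rightarrow> 'x val set"
  Init :: "'l \<Rightarrow> 'x val set"

(* A transition is either controllable or uncontrollable, hence the disjointness. *)

definition LHA :: "('l, 'x::finite) automaton \<Rightarrow> bool" where
  "LHA H \<longleftrightarrow>
     finite (Loc H) \<and> finite (Edgc H) \<and> finite (Edgu H) \<and> Edgc H \<inter> Edgu H = {} \<and>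
     (\<forall>(l, \<mu>, l') \<in> Edgc H \<union> Edgu H. l \<in> Loc H \<and> l' \<in> Loc H \<and> polyhedral \<mu>) \<and>
     (\<forall>l \<in> Loc H. convex_polyhedral (Flow H l) \<and> polyhedral (Inv H l) \<and>
        polyhedral (Init H l) \<and> Init H l \<subseteq> Inv H l)"

definition States :: "('l, 'x) automaton \<Rightarrow> ('l, 'x) state set" where
  "States H = Loc H \<times> UNIV"

definition InvS :: "('l, 'x) automaton \<Rightarrow> ('l, 'x) state set" where
  "InvS H = (\<Union>l\<in>Loc H. {l} \<times> Inv H l)"

definition InitS :: "('l, 'x) automaton \<Rightarrow> ('l, 'x) state set" where
  "InitS H = (\<Union>l\<in>Loc H. {l} \<times> Init H l)"

abbreviation loc :: "('l, 'x) state \<Rightarrow> 'l" where "loc \<equiv> fst"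
abbreviation val :: "('l, 'x) state \<Rightarrow> 'x val" where "val \<equiv> snd"

(* Activities are functions on the nonnegative reals: their values at negative arguments are
   irrelevant throughout, and the derivative at 0 is one-sided. *)

definition activity :: "(real \<Rightarrow> 'x::finite val) \<Rightarrow> bool" where
  "activity f \<longleftrightarrow> f differentiable_on {0..}"

definition Adm :: "('l, 'x::finite) automaton \<Rightarrow> ('l, 'x) state \<Rightarrow> (real \<Rightarrow> 'x val) set" where
  "Adm H s = {f. activity f \<and> f 0 = val s \<and>
     (\<forall>\<delta>\<ge>0. vector_derivative f (at \<delta> within {0..}) \<in> Flow H (loc s))}"

(* For \<delta> = \<infinity> the condition says that f stays in the invariant forever. *)

definition tspan :: "('l, 'x) automaton \<Rightarrow> (real \<Rightarrow> 'x val) \<Rightarrow> 'l \<Rightarrow> ereal set" where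
  "tspan H f l = {\<delta>. 0 \<le> \<delta> \<and> (\<forall>\<delta>'\<ge>0. ereal \<delta>' \<le> \<delta> \<longrightarrow> (l, f \<delta>') \<in> InvS H)}"

definition discrete_step ::
  "('l, 'x) automaton \<Rightarrow> ('l, 'x) state \<Rightarrow> ('l, 'x) edge \<Rightarrow> ('l, 'x) state \<Rightarrow> bool" where
  "discrete_step H s e s' \<longleftrightarrow>
     s \<in> InvS H \<and> s' \<in> InvS H \<and> e \<in> Edgc H \<union> Edgu H \<and>
     (\<exists>\<mu>. e = (loc s, \<mu>, loc s') \<and> (val s, val s') \<in> \<mu>)"

definition timed_step ::
  "('l, 'x::finite) automaton \<Rightarrow> ('l, 'x) state \<Rightarrow> real \<Rightarrow> (real \<Rightarrow> 'x val) \<Rightarrow>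
   ('l, 'x) state \<Rightarrow> bool" where
  "timed_step H s \<delta> f s' \<longleftrightarrow>
     s \<in> InvS H \<and> f \<in> Adm H s \<and> ereal \<delta> \<in> tspan H f (loc s) \<and> s' = (loc s, f \<delta>)"

definition infinite_timed_step ::
  "('l, 'x::finite) automaton \<Rightarrow> ('l, 'x) state \<Rightarrow> (real \<Rightarrow> 'x val) \<Rightarrow> bool" where
  "infinite_timed_step H s f \<longleftrightarrow> s \<in> InvS H \<and> f \<in> Adm H s \<and> \<infinity> \<in> tspan H f (loc s)"

(* A sequence of alternating steps: st i is s_i, st' i is s_i', and len is the number of
   discrete steps. If len is finite then the timed steps are numbered 0, ..., len and the last
   one has infinite duration. Components with indices beyond that carry no information. *)

record ('l, 'x) step_seq =
  len :: enat
  st :: "nat \<Rightarrow> ('l, 'x) state"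
  delay :: "nat \<Rightarrow> ereal"
  act :: "nat \<Rightarrow> real \<Rightarrow> 'x val"
  st' :: "nat \<Rightarrow> ('l, 'x) state"
  edg :: "nat \<Rightarrow> ('l, 'x) edge"

definition is_run :: "('l, 'x::finite) automaton \<Rightarrow> ('l, 'x) step_seq \<Rightarrow> bool" where
  "is_run H r \<longleftrightarrow>
     (\<forall>i. enat i < len r \<longrightarrow>
        (\<exists>\<delta>. delay r i = ereal \<delta> \<and> timed_step H (st r i) \<delta> (act r i) (st' r i)) \<and>
        discrete_step H (st' r i) (edg r i) (st r (Suc i))) \<and>
     (\<forall>n. len r = enat n \<longrightarrow>
        delay r n = \<infinity> \<and> infinite_timed_step H (st r n) (act r n))"

definition non_Zeno :: "('l, 'x) step_seq \<Rightarrow> bool" where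
  "non_Zeno r \<longleftrightarrow>
     (\<forall>\<delta>::real. \<delta> \<ge> 0 \<longrightarrow> (\<exists>i. enat i \<le> len r \<and> (\<Sum>j\<le>i. delay r j) > ereal \<delta>))"

definition well_formed :: "('l, 'x::finite) automaton \<Rightarrow> bool" where
  "well_formed H \<longleftrightarrow>
     (\<forall>r. is_run H r \<longrightarrow> non_Zeno r) \<and>
     (\<forall>s \<in> InvS H. (\<forall>f \<in> Adm H s. \<infinity> \<notin> tspan H f (loc s)) \<longrightarrow>
        (\<exists>f \<in> Adm H s. \<exists>\<delta>::real. ereal \<delta> \<in> tspan H f (loc s) \<and> (loc s, f \<delta>) \<in> InvS H \<and>
           (\<exists>e \<in> Edgu H. \<exists>s''. discrete_step H (loc s, f \<delta>) e s'')))"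

(* The null action is None. Only the values of a strategy on States H matter. *)

type_synonym ('l, 'x) strategy = "('l, 'x) state \<Rightarrow> ('l, 'x) edge option set"

definition is_strategy :: "('l, 'x::finite) automaton \<Rightarrow> ('l, 'x) strategy \<Rightarrow> bool" where
  "is_strategy H \<sigma> \<longleftrightarrow>
     (\<forall>s \<in> States H.
        \<sigma> s \<subseteq> Some ` Edgc H \<union> {None} \<and> \<sigma> s \<noteq> {} \<and>
        (\<forall>e \<in> Edgc H. Some e \<in> \<sigma> s \<longrightarrow> (\<exists>s'. discrete_step H s e s')) \<and>
        (None \<in> \<sigma> s \<longrightarrow>
           (\<forall>f \<in> Adm H s. \<exists>\<delta>>0. \<forall>\<delta>'. 0 < \<delta>' \<and> \<delta>' < \<delta> \<longrightarrow>
              ereal \<delta>' \<notin> tspan H f (loc s) \<or> None \<in> \<sigma> (loc s, f \<delta>'))))"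

(* The requirement on the null action also covers a final timed step of infinite duration. *)

definition consistent :: "('l, 'x) automaton \<Rightarrow> ('l, 'x) strategy \<Rightarrow> ('l, 'x) step_seq \<Rightarrow> bool" where
  "consistent H \<sigma> r \<longleftrightarrow>
     (\<forall>i. enat i \<le> len r \<longrightarrow>
        (\<forall>\<delta>\<ge>0. ereal \<delta> < delay r i \<longrightarrow> None \<in> \<sigma> (loc (st r i), act r i \<delta>))) \<and>
     (\<forall>i. enat i < len r \<longrightarrow> edg r i \<in> Edgc H \<longrightarrow> Some (edg r i) \<in> \<sigma> (st' r i))"

end

(* From every state of the invariant one can continue consistently. If some admissible activity
   stays in the invariant forever, follow it; otherwise well-formedness supplies an activity
   leading to an uncontrollable transition. In either case, follow the activity up to the first
   time at which the strategy forbids the null action. That infimum is attained because the null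
   action, where allowed, remains allowed for some time along every activity; there a controllable
   transition is prescribed, hence enabled. Iterating such continuations gives the run. *)

theory Submission
  imports Defs
begin

lemma tspan_finite_iff:
  "ereal d \<in> tspan H f l \<longleftrightarrow> 0 \<le> d \<and> (\<forall>t. 0 \<le> t \<and> t \<le> d \<longrightarrow> (l, f t) \<in> InvS H)"
  by (auto simp: tspan_def zero_ereal_def)

lemma tspan_downward: "d \<in> tspan H f l \<Longrightarrow> 0 \<le> t \<Longrightarrow> ereal t \<le> d \<Longrightarrow> ereal t \<in> tspan H f l"
  by (cases d) (auto simp: tspan_def)

lemma tspan_InvS: "ereal t \<in> tspan H f l \<Longrightarrow> (l, f t) \<in> InvS H"
  by (simp add: tspan_finite_iff)

lemma InvS_States: "s \<in> InvS H \<Longrightarrow> s \<in> States H"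
  by (auto simp: InvS_def States_def)

text \<open>Translation by \<open>T\<close> carries {0..} into itself because \<open>T\<close> is
  nonnegative, so the chain rule applies to derivatives within {0..}; at time 0 this leaves a
  one-sided derivative. The lemma restarts an activity midway, where the persistence condition on
  the null action can then be invoked.\<close>

lemma Adm_shift:
  assumes f: "f \<in> Adm H (l, v)" and T: "0 \<le> T"
  shows "(\<lambda>t. f (T + t)) \<in> Adm H (l, f T)"
proof -
  let ?g = "\<lambda>t. f (T + t)"
  have "\<exists>D. (?g has_vector_derivative D) (at t within {0..}) \<and> D \<in> Flow H l"
    if t: "0 \<le> t" for t
  proof -
    let ?D = "vector_derivative f (at (T + t) within {0..})"
    have "f differentiable (at (T + t) within {0..})"
      using f T t by (auto simp: Adm_def activity_def differentiable_on_def)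
    then have "(f has_vector_derivative ?D) (at (T + t) within {0..})"
      by (simp add: vector_derivative_works)
    then have "(f has_vector_derivative ?D) (at (T + t) within (+) T ` {0..})"
      by (rule has_vector_derivative_within_subset) (use T in auto)
    then have "(f \<circ> (+) T has_vector_derivative 1 *\<^sub>R ?D) (at t within {0..})"
      by (intro vector_diff_chain_within) (auto intro!: derivative_eq_intros)
    moreover have "?D \<in> Flow H l"
      using f T t by (auto simp: Adm_def)
    ultimately show ?thesis
      by (auto simp: o_def)
  qed
  then obtain D where
    D: "\<And>t. 0 \<le> t \<Longrightarrow> (?g has_vector_derivative D t) (at t within {0..}) \<and> D t \<in> Flow H l"
    by metis
  \<comment> \<open>\<open>vector_derivative\<close> is defined by choice, so identifying it with
    \<open>D t\<close> needs uniqueness of the derivative. Points to the right of \<open>t\<close>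
    make \<open>t\<close> a limit point of {0..}, even when \<open>t\<close> is 0.\<close>
  moreover have "vector_derivative ?g (at t within {0..}) = D t" if "0 \<le> t" for t
  proof (rule vector_derivative_within)
    have "at t within {t<..} \<noteq> bot"
      by (simp add: trivial_limit_at_right_real)
    then show "at t within {0..} \<noteq> bot"
      using at_le[of "{t<..}" "{0..}" t] that by (force simp: bot.extremum_unique)
  qed (use D that in auto)
  ultimately show ?thesis
    by (auto simp: Adm_def activity_def differentiable_on_def intro: differentiableI_vector)
qed

text \<open>Values of a strategy are nonempty on \<open>States H\<close>, so without the null action
  some controllable edge remains, and prescribed edges are enabled.\<close>

lemma strategy_controllable:
  assumes "is_strategy H \<sigma>" "s \<in> InvS H" "None \<notin> \<sigma> s"
  obtains e s' where "e \<in> Edgc H" "Some e \<in> \<sigma> s" "discrete_step H s e s'"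
proof -
  note \<sigma> = assms(1)[unfolded is_strategy_def, rule_format, OF InvS_States[OF assms(2)]]
  obtain a where a: "a \<in> \<sigma> s"
    using \<sigma> by blast
  moreover obtain e where "a = Some e" "e \<in> Edgc H"
    using \<sigma> a assms(3) by blast
  ultimately show ?thesis
    using \<sigma> that by blast
qed

text \<open>Taking \<open>d\<close> as an extended real treats a finite delay and staying forever
  alike. A null action forbidden only at \<open>d\<close> itself falls under the first case: a timed
  step needs it only before its end.\<close>

lemma first_forbidden_time:
  assumes \<sigma>: "is_strategy H \<sigma>" and f: "f \<in> Adm H (l, v)" and d: "d \<in> tspan H f l"
  obtains "\<forall>t\<ge>0. ereal t < d \<longrightarrow> None \<in> \<sigma> (l, f t)"
  | T where "0 \<le> T" "ereal T < d" "\<forall>t\<ge>0. t < T \<longrightarrow> None \<in> \<sigma> (l, f t)" "None \<notin> \<sigma> (l, f T)"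
proof -
  define B where "B = {t. 0 \<le> t \<and> ereal t < d \<and> None \<notin> \<sigma> (l, f t)}"
  show thesis
  proof (cases "B = {}")
    case True
    then show ?thesis
      using that(1) by (auto simp: B_def)
  next
    case False
    then obtain b where b: "b \<in> B"
      by blast
    have bdd: "bdd_below B"
      by (auto simp: B_def intro: bdd_belowI[of _ 0])
    have nonneg: "0 \<le> Inf B"
      using False by (intro cInf_greatest) (auto simp: B_def)
    have "Inf B \<le> b"
      using b bdd by (rule cInf_lower)
    then have less: "ereal (Inf B) < d"
      using b by (auto simp: B_def intro: le_less_trans[of _ "ereal b"])
    have before: "\<forall>t\<ge>0. t < Inf B \<longrightarrow> None \<in> \<sigma> (l, f t)"
    proof (intro allI impI)
      fix t assume t: "0 \<le> t" "t < Inf B"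
      then have "t \<notin> B"
        using cInf_lower[OF _ bdd, of t] by auto
      moreover have "ereal t < d"
        using t less by (auto intro: less_trans[of _ "ereal (Inf B)"])
      ultimately show "None \<in> \<sigma> (l, f t)"
        using t by (auto simp: B_def)
    qed
    have "None \<notin> \<sigma> (l, f (Inf B))"
    proof
      let ?g = "\<lambda>t. f (Inf B + t)"
      assume null: "None \<in> \<sigma> (l, f (Inf B))"
      have "(l, f (Inf B)) \<in> States H"
        using tspan_downward[OF d nonneg] less by (auto intro!: InvS_States tspan_InvS)
      then obtain \<epsilon> where \<epsilon>: "0 < \<epsilon>" and
        pers: "\<And>t. 0 < t \<Longrightarrow> t < \<epsilon> \<Longrightarrow> ereal t \<in> tspan H ?g l \<Longrightarrow> None \<in> \<sigma> (l, ?g t)"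
        using \<sigma> null Adm_shift[OF f nonneg] unfolding is_strategy_def by fastforce
      \<comment> \<open>No point of \<open>B\<close> lies below \<open>Inf B + \<epsilon>\<close>:
        \<open>Inf B\<close> is excluded by \<open>null\<close>, the times just after it by
        persistence. So a number larger than the infimum would be a lower bound.\<close>
      have "Inf B + \<epsilon> \<le> Inf B"
      proof (rule cInf_greatest[OF False], rule ccontr)
        fix t assume t: "t \<in> B" "\<not> Inf B + \<epsilon> \<le> t"
        have "Inf B \<le> t"
          using t bdd by (auto intro: cInf_lower)
        moreover have "t \<noteq> Inf B"
          using t null by (auto simp: B_def)
        \<comment> \<open>Persistence speaks only of times in the span of the shifted activity;
          these are inherited from \<open>f\<close>, whose span contains every time before
          \<open>d\<close>.\<close>
        moreover have "ereal t \<in> tspan H f l"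
          using t d by (intro tspan_downward) (auto simp: B_def)
        then have "ereal (t - Inf B) \<in> tspan H ?g l"
          using \<open>Inf B \<le> t\<close> nonneg by (auto simp: tspan_finite_iff)
        ultimately have "None \<in> \<sigma> (l, f t)"
          using pers[of "t - Inf B"] t by auto
        then show False
          using t by (simp add: B_def)
      qed
      then show False
        using \<epsilon> by simp
    qed
    then show ?thesis
      using that(2) nonneg less before by blast
  qed
qed

definition rest_step ::
  "('l, 'x::finite) automaton \<Rightarrow> ('l, 'x) strategy \<Rightarrow> ('l, 'x) state \<Rightarrow> (real \<Rightarrow> 'x val) \<Rightarrow> bool"
  where "rest_step H \<sigma> s f \<longleftrightarrow>
    infinite_timed_step H s f \<and> (\<forall>t\<ge>0. None \<in> \<sigma> (loc s, f t))"

text \<open>The strict bound \<open>t < d\<close> lets a controllable edge be taken at the very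
  state where the null action is first forbidden.\<close>

definition move_step ::
  "('l, 'x::finite) automaton \<Rightarrow> ('l, 'x) strategy \<Rightarrow> ('l, 'x) state \<Rightarrow> real \<Rightarrow> (real \<Rightarrow> 'x val) \<Rightarrow>
   ('l, 'x) edge \<Rightarrow> ('l, 'x) state \<Rightarrow> bool"
  where "move_step H \<sigma> s d f e s' \<longleftrightarrow>
    timed_step H s d f (loc s, f d) \<and> discrete_step H (loc s, f d) e s' \<and>
    (\<forall>t\<ge>0. t < d \<longrightarrow> None \<in> \<sigma> (loc s, f t)) \<and>
    (e \<in> Edgc H \<longrightarrow> Some e \<in> \<sigma> (loc s, f d))"

lemma move_step_InvS: "move_step H \<sigma> s d f e s' \<Longrightarrow> s' \<in> InvS H"
  by (simp add: move_step_def discrete_step_def)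

lemma move_step_at_forbidden_time:
  assumes \<sigma>: "is_strategy H \<sigma>" and s: "s \<in> InvS H" and f: "f \<in> Adm H s"
    and T: "ereal T \<in> tspan H f (loc s)" "\<forall>t\<ge>0. t < T \<longrightarrow> None \<in> \<sigma> (loc s, f t)"
    and forbidden: "None \<notin> \<sigma> (loc s, f T)"
  shows "\<exists>d f e s'. move_step H \<sigma> s d f e s'"
proof -
  obtain e s' where "e \<in> Edgc H" "Some e \<in> \<sigma> (loc s, f T)" "discrete_step H (loc s, f T) e s'"
    using strategy_controllable[OF \<sigma> tspan_InvS[OF T(1)] forbidden] by blast
  then have "move_step H \<sigma> s T f e s'"
    using s f T by (simp add: move_step_def timed_step_def)
  then show ?thesis
    by blast
qed

lemma consistent_progress:
  assumes H: "LHA H" and wf: "well_formed H" and \<sigma>: "is_strategy H \<sigma>" and s: "s \<in> InvS H"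
  shows "(\<exists>f. rest_step H \<sigma> s f) \<or> (\<exists>d f e s'. move_step H \<sigma> s d f e s')"
proof -
  \<comment> \<open>The first alternative will yield a rest step for infinite \<open>d\<close>, and
    for finite \<open>d\<close> the wait before an uncontrollable edge.\<close>
  have continue: "(\<forall>t\<ge>0. ereal t < d \<longrightarrow> None \<in> \<sigma> (loc s, f t)) \<or>
      (\<exists>d f e s'. move_step H \<sigma> s d f e s')"
    if f: "f \<in> Adm H s" and d: "d \<in> tspan H f (loc s)" for f d
  proof -
    have f': "f \<in> Adm H (loc s, val s)"
      using f by simp
    show ?thesis
    proof (cases rule: first_forbidden_time[OF \<sigma> f' d])
      case (2 T)
      have "ereal T \<in> tspan H f (loc s)"
        using d 2 by (intro tspan_downward) auto
      then show ?thesis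
        using move_step_at_forbidden_time[OF \<sigma> s f] 2 by blast
    qed auto
  qed
  show ?thesis
  proof (cases "\<exists>f\<in>Adm H s. \<infinity> \<in> tspan H f (loc s)")
    case True
    then obtain f where f: "f \<in> Adm H s" "\<infinity> \<in> tspan H f (loc s)"
      by blast
    show ?thesis
      using continue[OF f] f s by (auto simp: rest_step_def infinite_timed_step_def)
  next
    case False
    then obtain f d e s' where f: "f \<in> Adm H s" "ereal d \<in> tspan H f (loc s)"
      and e: "e \<in> Edgu H" "discrete_step H (loc s, f d) e s'"
      using wf s unfolding well_formed_def by meson
    \<comment> \<open>By disjointness of the two edge sets, the strategy imposes no condition on
      taking \<open>e\<close>.\<close>
    have "e \<notin> Edgc H"
      using H e(1) by (auto simp: LHA_def)
    then have "move_step H \<sigma> s d f e s'" if "\<forall>t\<ge>0. t < d \<longrightarrow> None \<in> \<sigma> (loc s, f t)"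
      using that f e s by (simp add: move_step_def timed_step_def)
    then show ?thesis
      using continue[OF f] by (metis less_ereal.simps(1))
  qed
qed

theorem theorem1:
  fixes H :: "('l, 'x::finite) automaton"
    and \<sigma> :: "('l, 'x) strategy"
    and s :: "('l, 'x) state"
  assumes "LHA H"
    and "well_formed H"
    and "is_strategy H \<sigma>"
    and "s \<in> InitS H"
  shows "\<exists>r. is_run H r \<and> st r 0 = s \<and> consistent H \<sigma> r"
proof -
  have s: "s \<in> InvS H"
    using assms(1,4) by (fastforce simp: LHA_def InitS_def InvS_def)
  define R where "R u \<longleftrightarrow> (\<exists>f. rest_step H \<sigma> u f)" for u
  have "\<forall>u. \<exists>f. R u \<longrightarrow> rest_step H \<sigma> u f"
    unfolding R_def by blast
  then obtain g where g: "\<And>u. R u \<Longrightarrow> rest_step H \<sigma> u (g u)"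
    by metis
  have "\<forall>u. \<exists>d f e u'. u \<in> InvS H \<and> \<not> R u \<longrightarrow> move_step H \<sigma> u d f e u'"
    using consistent_progress[OF assms(1,2,3)] unfolding R_def by blast
  then obtain d f e nx where
    move: "\<And>u. u \<in> InvS H \<Longrightarrow> \<not> R u \<Longrightarrow> move_step H \<sigma> u (d u) (f u) (e u) (nx u)"
    by metis
  define S where "S i = (nx ^^ i) s" for i
  \<comment> \<open>The run ends at the first state that admits a rest step. From there on
    \<open>nx\<close> is unconstrained, so facts about \<open>S\<close> are claimed only up to index
    \<open>L\<close>.\<close>
  define L where "L = (if \<exists>n. R (S n) then enat (LEAST n. R (S n)) else \<infinity>)"
  have stop: "R (S n)" if "L = enat n" for n
    using that LeastI_ex[of "\<lambda>n. R (S n)"] by (auto simp: L_def split: if_splits)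
  have go: "\<not> R (S i)" if "enat i < L" for i
    using that not_less_Least[of i "\<lambda>n. R (S n)"] by (auto simp: L_def split: if_splits)
  have InvS: "S i \<in> InvS H" if "enat i \<le> L" for i
    using that
  proof (induction i)
    case 0
    then show ?case
      using s by (simp add: S_def)
  next
    case (Suc i)
    then have "enat i < L"
      by (auto simp: Suc_ile_eq)
    then show ?case
      using move_step_InvS[OF move[OF Suc.IH go]] by (simp add: S_def)
  qed
  have mv: "move_step H \<sigma> (S i) (d (S i)) (f (S i)) (e (S i)) (S (Suc i))" if "enat i < L" for i
    using move[OF InvS go] that by (simp add: S_def)
  \<comment> \<open>At index \<open>L\<close> the activity switches from \<open>f\<close> to
    \<open>g\<close> and the delay becomes infinite.\<close>
  define r where "r = \<lparr>len = L, st = S,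
    delay = (\<lambda>i. if enat i < L then ereal (d (S i)) else \<infinity>),
    act = (\<lambda>i. if enat i < L then f (S i) else g (S i)),
    st' = (\<lambda>i. (loc (S i), f (S i) (d (S i)))),
    edg = (\<lambda>i. e (S i))\<rparr>"
  have "is_run H r"
    using mv g[OF stop] by (auto simp: is_run_def r_def move_step_def rest_step_def)
  moreover have "consistent H \<sigma> r"
    \<comment> \<open>\<open>le_less\<close> separates the moves before \<open>L\<close>, covered by
      \<open>mv\<close>, from the final rest step, covered by \<open>g\<close>.\<close>
    using mv g[OF stop]
    by (auto simp: consistent_def r_def move_step_def rest_step_def le_less)
  moreover have "st r 0 = s"
    by (simp add: r_def S_def)
  ultimately show ?thesis
    by blast
qed

end
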